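(* Let $g\colon\mathbb{R}^d\to\mathbb{R}^d$ be Borel measurable and satisfy $\|g(x)\|\le M_g\|x\|$ for every $x\in\mathbb{R}^d$, for some $M_g>0$. Let $\mathcal{E}\colon\mathbb{R}^d\to[0,+\infty)$ be continuous with $\mathcal{E}(0)=\min_{x\in\mathbb{R}^d}\mathcal{E}(x)=0$, and such that there exist $c,\nu>0$ with $$c\,\|x\|^\nu\le\mathcal{E}(x)\qquad\text{for every }x\in\mathbb{R}^d.$$ For $n\in\mathbb{N}$ and $\mu\in\mathcal{P}_1(\mathbb{R}^d)$ let $$f_n(\mu)=\frac{1}{\|\omega_n\|_{L^1_\mu}}\int_{\mathbb{R}^d}g(x)e^{-n\mathcal{E}(x)}\,d\mu(x),\qquad \omega_n(x)=e^{-n\mathcal{E}(x)}.$$ Then, for every function $\ell\colon(0,+\infty)\to(0,1)$ and every $R>0$, the sequence $f_n$ converges to $0$ uniformly, as $n\to\infty$, on the set $$E_{\ell,R}=\{\gamma\in\mathcal{P}_2(\mathbb{R}^d):\ m_2(\gamma)\le R,\ \gamma(B_r)\ge\ell(r)\ \text{for all } r>0\}.$$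
   Context: $\|\cdot\|$ is the Euclidean norm on $\mathbb{R}^d$, $d>1$; $B_r$ is the open ball of radius $r$ centered at $0$; $\mathcal{P}_q(\mathbb{R}^d)$ is the set of Borel probability measures with finite $q$-th moment and $m_q(\mu)=(\int\|x\|^qd\mu)^{1/q}$; $\|\omega_n\|_{L^1_\mu}=\int_{\mathbb{R}^d}\omega_n\,d\mu$. *)

theory Defs
  imports "HOL-Probability.Probability"
begin

text \<open>The exponent \<open>q\<close> is meant to be positive; then \<open>0 powr q = 0\<close>, so \<open>powr\<close> is the usual power here.\<close>

definition P_space :: "real \<Rightarrow> ('a::real_normed_vector) measure set" where
  "P_space q = {\<mu>. prob_space \<mu> \<and> sets \<mu> = sets borel \<and> integrable \<mu> (\<lambda>x. norm x powr q)}"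

definition moment :: "real \<Rightarrow> ('a::real_normed_vector) measure \<Rightarrow> real" where
  "moment q \<mu> = (\<integral>x. norm x powr q \<partial>\<mu>) powr (1 / q)"

definition weight :: "('a \<Rightarrow> real) \<Rightarrow> nat \<Rightarrow> 'a \<Rightarrow> real" where
  "weight \<E> n x = exp (- real n * \<E> x)"

text \<open>Only meant for \<open>\<mu> \<in> P_space 1\<close>, where the integrand of the vector-valued Bochner integral
  is integrable as soon as \<open>g\<close> is Borel with linear growth and \<open>\<E>\<close> is Borel and nonnegative.
  As \<open>weight \<E> n > 0\<close>, the normalising integral is the \<open>L\<^sup>1\<close> norm of the weight.\<close>

definition weighted_mean ::
  "('a \<Rightarrow> 'a) \<Rightarrow> ('a \<Rightarrow> real) \<Rightarrow> nat \<Rightarrow> 'a measure \<Rightarrow> ('a::euclidean_space)" where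
  "weighted_mean g \<E> n \<mu> =
     (1 / (\<integral>x. weight \<E> n x \<partial>\<mu>)) *\<^sub>R (\<integral>x. weight \<E> n x *\<^sub>R g x \<partial>\<mu>)"

definition E_set :: "(real \<Rightarrow> real) \<Rightarrow> real \<Rightarrow> ('a::real_normed_vector) measure set" where
  "E_set l R = {\<gamma> \<in> P_space 2. moment 2 \<gamma> \<le> R \<and> (\<forall>r>0. measure \<gamma> (ball 0 r) \<ge> l r)}"

end

theory Submission
  imports Defs
begin

text \<open>Fix \<open>s > 0\<close>. Inside the ball of radius \<open>s\<close> the mean of \<open>g\<close> is at most \<open>M s\<close>. Outside it the
  weight is at most \<open>exp (- 2 n q)\<close> with \<open>2 q = c s\<^sup>\<nu>\<close>, while by continuity \<open>\<E> \<le> q\<close> on a small ball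
  of radius \<open>r\<close>, so the normalising constant is at least \<open>exp (- n q) l(r)\<close>. With the second moment
  bounding the integral of \<open>\<parallel>x\<parallel>\<close>, the outer contribution decays like \<open>exp (- n q)\<close> uniformly.\<close>

lemma E_set_second_moment:
  assumes "\<mu> \<in> E_set l R"
  shows "integrable \<mu> (\<lambda>x. (norm x)\<^sup>2)" "(\<integral>x. (norm x)\<^sup>2 \<partial>\<mu>) \<le> R\<^sup>2"
proof -
  define I where "I = (\<integral>x. (norm x)\<^sup>2 \<partial>\<mu>)"
  have I0: "0 \<le> I"
    unfolding I_def by simp
  show "integrable \<mu> (\<lambda>x. (norm x)\<^sup>2)"
    using assms by (simp add: E_set_def P_space_def powr_numeral)
  have "sqrt I \<le> R"
    using assms I0 by (simp add: E_set_def moment_def powr_numeral powr_half_sqrt I_def)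
  \<comment> \<open>Squaring is monotone here because \<open>0 \<le> sqrt I\<close>; the
    nonnegativity of \<open>R\<close> follows from the same chain.\<close>
  hence "(sqrt I)\<^sup>2 \<le> R\<^sup>2"
    using I0 by (intro power_mono) auto
  thus "(\<integral>x. (norm x)\<^sup>2 \<partial>\<mu>) \<le> R\<^sup>2"
    using I0 by (simp add: I_def)
qed

lemma integrable_weight:
  assumes "prob_space \<mu>" "sets \<mu> = sets borel" "\<E> \<in> borel_measurable borel" "\<And>x. 0 \<le> \<E> x"
  shows "integrable \<mu> (weight \<E> n)"
proof -
  interpret prob_space \<mu> by fact
  have [measurable]: "\<E> \<in> borel_measurable \<mu>"
    using assms by (simp add: measurable_cong_sets[OF assms(2) refl])
  show ?thesis
    unfolding weight_def
    by (rule integrable_const_bound[where B = 1]) (use assms(4) in auto)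
qed

text \<open>A Markov-type estimate: the weight is at least \<open>exp (- real n * q)\<close> on the
  ball and positive elsewhere, so it dominates that constant times the indicator. It keeps the
  normalising constant from decaying faster than \<open>exp (- q) ^ n\<close>.\<close>

lemma weight_integral_lower_bound:
  assumes "prob_space \<mu>" "sets \<mu> = sets borel" "\<E> \<in> borel_measurable borel" "\<And>x. 0 \<le> \<E> x"
    and q: "\<And>x. norm x < r \<Longrightarrow> \<E> x \<le> q"
  shows "exp (- real n * q) * measure \<mu> (ball 0 r) \<le> (\<integral>x. weight \<E> n x \<partial>\<mu>)"
proof -
  interpret prob_space \<mu> by fact
  have B: "ball 0 r \<in> sets \<mu>"
    using assms(2) by simp
  have "exp (- real n * q) * measure \<mu> (ball 0 r)
      = (\<integral>x. exp (- real n * q) * indicator (ball 0 r) x \<partial>\<mu>)"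
    using B by simp
  also have "\<dots> \<le> (\<integral>x. weight \<E> n x \<partial>\<mu>)"
  proof (rule integral_mono)
    show "integrable \<mu> (\<lambda>x. exp (- real n * q) * indicator (ball 0 r) x)"
      using B by (intro integrable_mult_right integrable_real_indicator) (auto simp: emeasure_eq_measure)
    show "integrable \<mu> (weight \<E> n)"
      by (rule integrable_weight) fact+
    show "exp (- real n * q) * indicator (ball 0 r) x \<le> weight \<E> n x" for x
      using q[of x] by (auto simp: weight_def indicator_def intro!: mult_left_mono)
  qed
  finally show ?thesis .
qed

text \<open>The right-hand side involves \<mu> only through \<open>l r\<close> and \<open>R\<close>,
  which is where uniformity comes from. The gap between \<open>q\<close> near the origin and
  \<open>2 * q\<close> far out produces the geometric decay.\<close>

lemma norm_weighted_mean_le: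
  fixes g :: "'a::euclidean_space \<Rightarrow> 'a"
  assumes \<mu>: "\<mu> \<in> E_set l R"
    and g: "\<And>x. norm (g x) \<le> M * norm x" and "0 \<le> M"
    and \<E>: "\<E> \<in> borel_measurable borel" "\<And>x. 0 \<le> \<E> x"
    and in_r: "\<And>x. norm x < r \<Longrightarrow> \<E> x \<le> q" and "0 < r" "0 < l r"
    and out_s: "\<And>x. s \<le> norm x \<Longrightarrow> 2 * q \<le> \<E> x" and "0 \<le> s"
  shows "norm (weighted_mean g \<E> n \<mu>) \<le> M * s + M * (1 + R\<^sup>2) / l r * exp (- q) ^ n"
proof -
  have P: "prob_space \<mu>" and S: "sets \<mu> = sets borel" and l: "l r \<le> measure \<mu> (ball 0 r)"
    using \<mu> \<open>0 < r\<close> by (auto simp: E_set_def P_space_def)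
  interpret prob_space \<mu> by fact
  define W where "W = (\<integral>x. weight \<E> n x \<partial>\<mu>)"
  \<comment> \<open>On the inner ball the weight is at least \<open>h\<close>, beyond radius
    \<open>s\<close> at most \<open>h * h\<close>; division by \<open>W\<close> will leave a single
    factor \<open>h\<close>.\<close>
  define h where "h = exp (- real n * q)"
  have h0: "0 < h" by (simp add: h_def)
  have hh: "exp (- real n * (2 * q)) = h * h"
    by (simp add: h_def flip: exp_add)
  have iw: "integrable \<mu> (weight \<E> n)"
    by (rule integrable_weight[OF P S \<E>])
  note i2 = E_set_second_moment[OF \<mu>]
  have "h * l r \<le> h * measure \<mu> (ball 0 r)"
    using l h0 by simp
  also have "\<dots> \<le> W"
    unfolding W_def h_def by (rule weight_integral_lower_bound[OF P S \<E> in_r])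
  finally have W: "h * l r \<le> W" .
  have hl: "0 < h * l r"
    using h0 \<open>0 < l r\<close> by simp
  have "norm (\<integral>x. weight \<E> n x *\<^sub>R g x \<partial>\<mu>) \<le> (\<integral>x. norm (weight \<E> n x *\<^sub>R g x) \<partial>\<mu>)"
    by (rule integral_norm_bound)
  \<comment> \<open>One majorant replaces splitting the domain: the first summand handles
    \<open>norm x < s\<close>, the second the rest, and both are nonnegative. The nonnegativity goal
    covers the default value 0 of a Bochner integral.\<close>
  also have "\<dots> \<le> (\<integral>x. M * s * weight \<E> n x + M * (h * h) * (1 + (norm x)\<^sup>2) \<partial>\<mu>)"
  proof (rule integral_mono')
    show "integrable \<mu> (\<lambda>x. M * s * weight \<E> n x + M * (h * h) * (1 + (norm x)\<^sup>2))"
      using iw i2(1) by auto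
    show "0 \<le> M * s * weight \<E> n x + M * (h * h) * (1 + (norm x)\<^sup>2)" for x
      using \<open>0 \<le> M\<close> \<open>0 \<le> s\<close> by (simp add: weight_def)
    show "norm (weight \<E> n x *\<^sub>R g x)
        \<le> M * s * weight \<E> n x + M * (h * h) * (1 + (norm x)\<^sup>2)" for x
    proof -
      have w0: "0 < weight \<E> n x" by (simp add: weight_def)
      have "norm (weight \<E> n x *\<^sub>R g x) \<le> weight \<E> n x * (M * norm x)"
        using g[of x] w0 by simp
      also have "\<dots> \<le> M * s * weight \<E> n x + M * (h * h) * (1 + (norm x)\<^sup>2)"
      proof (cases "norm x < s")
        case True
        hence "weight \<E> n x * (M * norm x) \<le> weight \<E> n x * (M * s)"
          using w0 \<open>0 \<le> M\<close> by (intro mult_left_mono) auto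
        moreover have "0 \<le> M * (h * h) * (1 + (norm x)\<^sup>2)"
          using \<open>0 \<le> M\<close> h0 by simp
        ultimately show ?thesis by (simp add: mult_ac)
      next
        case False
        hence "real n * (2 * q) \<le> real n * \<E> x"
          using out_s[of x] by (intro mult_left_mono) auto
        hence "weight \<E> n x \<le> h * h"
          unfolding hh[symmetric] by (simp add: weight_def)
        \<comment> \<open>From \<open>2 * t \<le> 1 + t^2\<close> with \<open>t \<ge> 0\<close>;
          this passes from linear growth to the second moment controlled by
          \<open>R\<close>.\<close>
        moreover have "norm x \<le> 1 + (norm x)\<^sup>2"
          using sum_squares_bound[of 1 "norm x"] norm_ge_zero[of x]
          by (simp del: norm_ge_zero)
        ultimately have "weight \<E> n x * (M * norm x) \<le> h * h * (M * (1 + (norm x)\<^sup>2))"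
          using w0 \<open>0 \<le> M\<close> by (intro mult_mono mult_left_mono) auto
        moreover have "0 \<le> M * s * weight \<E> n x"
          using \<open>0 \<le> M\<close> \<open>0 \<le> s\<close> w0 by simp
        ultimately show ?thesis by (simp add: mult_ac)
      qed
      finally show "norm (weight \<E> n x *\<^sub>R g x)
          \<le> M * s * weight \<E> n x + M * (h * h) * (1 + (norm x)\<^sup>2)" .
    qed
  qed
  also have "\<dots> = M * s * W + M * (h * h) * (1 + (\<integral>x. (norm x)\<^sup>2 \<partial>\<mu>))"
    using iw i2(1) by (simp add: W_def prob_space)
  also have "\<dots> \<le> M * s * W + M * (h * h) * (1 + R\<^sup>2)"
    using i2(2) \<open>0 \<le> M\<close> h0 by (intro add_left_mono mult_left_mono) auto
  finally have "norm (weighted_mean g \<E> n \<mu>) \<le> (M * s * W + M * (h * h) * (1 + R\<^sup>2)) / W"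
    using hl W by (simp add: weighted_mean_def W_def[symmetric] divide_right_mono)
  also have "\<dots> = M * s + M * (h * h) * (1 + R\<^sup>2) / W"
    using hl W by (simp add: add_divide_distrib)
  \<comment> \<open>In the inner term \<open>W\<close> has cancelled exactly; only the outer term
    needs the lower bound \<open>h * l r\<close>.\<close>
  also have "\<dots> \<le> M * s + M * (h * h) * (1 + R\<^sup>2) / (h * l r)"
    using hl W h0 \<open>0 \<le> M\<close> by (intro add_left_mono divide_left_mono) auto
  also have "\<dots> = M * s + M * (1 + R\<^sup>2) / l r * h"
    using h0 \<open>0 < l r\<close> by (simp add: field_simps)
  also have "h = exp (- q) ^ n"
    by (simp add: h_def flip: exp_of_nat_mult)
  finally show ?thesis .
qed

theorem proposition5p3:
  fixes g :: "real^'d \<Rightarrow> real^'d" and \<E> :: "real^'d \<Rightarrow> real"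
    and M\<^sub>g c \<nu> R :: real and l :: "real \<Rightarrow> real"
  assumes "CARD('d) > 1"
    and "g \<in> borel_measurable borel"
    and "M\<^sub>g > 0" and "\<And>x. norm (g x) \<le> M\<^sub>g * norm x"
    and "continuous_on UNIV \<E>"
    and "\<And>x. 0 \<le> \<E> x" and "\<And>x. \<E> 0 \<le> \<E> x" and "\<E> 0 = 0"
    and "c > 0" and "\<nu> > 0" and "\<And>x. c * norm x powr \<nu> \<le> \<E> x"
    and "\<And>r. r > 0 \<Longrightarrow> 0 < l r \<and> l r < 1"
    and "R > 0"
  shows "uniform_limit (E_set l R) (weighted_mean g \<E>) (\<lambda>_. 0) sequentially"
proof (rule uniform_limitI)
  fix e :: real assume "0 < e"
  \<comment> \<open>Chosen so that the inner contribution is exactly \<open>e / 2\<close>.\<close>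
  define s where "s = e / (2 * M\<^sub>g)"
  have s: "0 < s" "M\<^sub>g * s = e / 2"
    using \<open>0 < e\<close> \<open>M\<^sub>g > 0\<close> by (simp_all add: s_def)
  \<comment> \<open>Half of the growth bound at radius \<open>s\<close>, so that \<E> is at least
    \<open>2 * q\<close> outside.\<close>
  define q where "q = c * s powr \<nu> / 2"
  have q: "0 < q"
    using s \<open>c > 0\<close> by (simp add: q_def)
  \<comment> \<open>Continuity at 0 gives \<open>r\<close> depending on \<open>q\<close> but not on
    the measure, so \<open>l r\<close> is one fixed positive constant.\<close>
  obtain r where r: "0 < r" "\<And>x. norm x < r \<Longrightarrow> \<E> x \<le> q"
  proof -
    obtain d where d: "d > 0" "\<And>x. dist x 0 < d \<Longrightarrow> dist (\<E> x) (\<E> 0) < q"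
      using assms(5) q unfolding continuous_on_iff by (metis UNIV_I)
    show ?thesis
    proof (rule that[OF d(1)])
      show "\<E> x \<le> q" if "norm x < d" for x
        using d(2)[of x] that \<open>\<E> 0 = 0\<close> by (simp add: dist_norm)
    qed
  qed
  have out: "2 * q \<le> \<E> x" if "s \<le> norm x" for x
  proof -
    have "c * s powr \<nu> \<le> c * norm x powr \<nu>"
      using that s \<open>c > 0\<close> \<open>\<nu> > 0\<close> by (intro mult_left_mono powr_mono2) auto
    thus ?thesis
      using assms(11)[of x] by (simp add: q_def)
  qed
  have "\<E> \<in> borel_measurable borel"
    using assms(5) by (rule borel_measurable_continuous_onI)
  hence bound: "norm (weighted_mean g \<E> n \<mu>) \<le> M\<^sub>g * s + M\<^sub>g * (1 + R\<^sup>2) / l r * exp (- q) ^ n"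
    if "\<mu> \<in> E_set l R" for n \<mu>
    using that assms(3,4,6) assms(12)[OF r(1)] r out s(1)
    by (intro norm_weighted_mean_le) auto
  \<comment> \<open>The prefactor is independent of \<open>n\<close> and \<mu>, so a single
    threshold for \<open>n\<close> serves the whole of \<open>E_set l R\<close>.\<close>
  have "(\<lambda>n. M\<^sub>g * (1 + R\<^sup>2) / l r * exp (- q) ^ n) \<longlonglongrightarrow> M\<^sub>g * (1 + R\<^sup>2) / l r * 0"
    using q by (intro tendsto_mult tendsto_const LIMSEQ_power_zero) auto
  hence "\<forall>\<^sub>F n in sequentially. M\<^sub>g * (1 + R\<^sup>2) / l r * exp (- q) ^ n < e / 2"
    using \<open>0 < e\<close> by (intro order_tendstoD(2)) auto
  thus "\<forall>\<^sub>F n in sequentially. \<forall>\<mu>\<in>E_set l R. dist (weighted_mean g \<E> n \<mu>) 0 < e"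
  proof eventually_elim
    case (elim n)
    show ?case
    proof
      fix \<mu> :: "(real^'d) measure" assume "\<mu> \<in> E_set l R"
      from bound[OF this, of n] elim s(2)
      show "dist (weighted_mean g \<E> n \<mu>) 0 < e"
        unfolding norm_conv_dist[symmetric] by linarith
    qed
  qed
qed

end
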